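(* Let $S$ be a Boolean inverse $\wedge$-monoid. Then its associated Boolean groupoid $\mathsf{G}(S)$ is principal if and only if $S$ is basic.
   Context: An inverse semigroup is a semigroup $S$ in which each $s$ has a unique $s^{-1}$ with $s=ss^{-1}s$, $s^{-1}=s^{-1}ss^{-1}$. All inverse monoids have a zero $0$. $E(S)$ is the set of idempotents (they commute), ordered by $e\le f\iff e=ef$. The natural partial order is $s\le t\iff s=ts^{-1}s$; meets $\wedge$ and joins $\vee$ are taken with respect to it. $a,b$ are compatible if $ab^{-1}$ and $a^{-1}b$ are idempotents. $S$ is distributive if every compatible pair has a join and multiplication distributes over all binary joins that exist. A Boolean inverse monoid is a distributive inverse monoid whose idempotents form a Boolean algebra; it is a Boolean inverse $\wedge$-monoid if in addition every pair of elements has a meet. An infinitesimal is a non-zero $s\in S$ with $s^2=0$. A Boolean inverse monoid is basic if each non-zero element is a join of a finite (possibly empty) set of infinitesimals and an idempotent (possibly $0$). $\mathsf{G}(S)$ is the set of ultrafilters of $S$ (maximal among nonempty subsets not containing $0$ that are closed under finite meets and upward closed), a groupoid with $\mathbf{d}(A)=(A^{-1}A)^{\uparrow}$, $\mathbf{r}(A)=(AA^{-1})^{\uparrow}$ (upward closures) and product $A\cdot B=(AB)^{\uparrow}$ when $\mathbf{d}(A)=\mathbf{r}(B)$, topologized by the basis $V_a=\{A: a\in A\}$, $a\in S$. A groupoid $G$ is principal if $\{g\in G: g^{-1}g=gg^{-1}\}$ consists only of identities. *)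

theory Defs
  imports "HOL-Algebra.Coset" "HOL-Algebra.Lattice" "HOL-Analysis.Abstract_Topology"
begin

section \<open>Inverse monoids\<close>

text \<open>The library operation \<open>inv\<close> is the group inverse, so inverse semigroups need their own.\<close>

definition inverse_of :: "('a, 'b) monoid_scheme \<Rightarrow> 'a \<Rightarrow> 'a \<Rightarrow> bool" where
  "inverse_of S s t \<longleftrightarrow>
     t \<in> carrier S \<and> s = s \<otimes>\<^bsub>S\<^esub> t \<otimes>\<^bsub>S\<^esub> s \<and> t = t \<otimes>\<^bsub>S\<^esub> s \<otimes>\<^bsub>S\<^esub> t"

definition sinv :: "('a, 'b) monoid_scheme \<Rightarrow> 'a \<Rightarrow> 'a" where
  "sinv S s = (THE t. inverse_of S s t)"

definition is_zero :: "('a, 'b) monoid_scheme \<Rightarrow> 'a \<Rightarrow> bool" where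
  "is_zero S z \<longleftrightarrow>
     z \<in> carrier S \<and> (\<forall>s \<in> carrier S. z \<otimes>\<^bsub>S\<^esub> s = z \<and> s \<otimes>\<^bsub>S\<^esub> z = z)"

definition szero :: "('a, 'b) monoid_scheme \<Rightarrow> 'a" where
  "szero S = (THE z. is_zero S z)"

text \<open>All inverse monoids are assumed to have a zero.\<close>

locale inverse_monoid = monoid S for S (structure) +
  assumes ex1_inverse: "s \<in> carrier S \<Longrightarrow> \<exists>!t. inverse_of S s t"
    and ex_zero: "\<exists>z. is_zero S z"

definition idempotents :: "('a, 'b) monoid_scheme \<Rightarrow> 'a set" where
  "idempotents S = {e \<in> carrier S. e \<otimes>\<^bsub>S\<^esub> e = e}"

definition natural_order :: "('a, 'b) monoid_scheme \<Rightarrow> 'a gorder" where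
  "natural_order S =
     \<lparr>carrier = carrier S, eq = (=), le = (\<lambda>s t. s = t \<otimes>\<^bsub>S\<^esub> sinv S s \<otimes>\<^bsub>S\<^esub> s)\<rparr>"

definition idempotent_order :: "('a, 'b) monoid_scheme \<Rightarrow> 'a gorder" where
  "idempotent_order S =
     \<lparr>carrier = idempotents S, eq = (=), le = (\<lambda>e f. e = e \<otimes>\<^bsub>S\<^esub> f)\<rparr>"

definition is_join :: "('a, 'b) monoid_scheme \<Rightarrow> 'a \<Rightarrow> 'a set \<Rightarrow> bool" where
  "is_join S j A \<longleftrightarrow> least (natural_order S) j (Upper (natural_order S) A)"

definition is_meet :: "('a, 'b) monoid_scheme \<Rightarrow> 'a \<Rightarrow> 'a set \<Rightarrow> bool" where
  "is_meet S m A \<longleftrightarrow> greatest (natural_order S) m (Lower (natural_order S) A)"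

definition compatible :: "('a, 'b) monoid_scheme \<Rightarrow> 'a \<Rightarrow> 'a \<Rightarrow> bool" where
  "compatible S a b \<longleftrightarrow>
     a \<otimes>\<^bsub>S\<^esub> sinv S b \<in> idempotents S \<and> sinv S a \<otimes>\<^bsub>S\<^esub> b \<in> idempotents S"

section \<open>Boolean inverse monoids\<close>

locale distributive_inverse_monoid = inverse_monoid +
  assumes compatible_join:
      "\<lbrakk>a \<in> carrier S; b \<in> carrier S; compatible S a b\<rbrakk> \<Longrightarrow> \<exists>j. is_join S j {a, b}"
    and join_distrib_left:
      "\<lbrakk>a \<in> carrier S; b \<in> carrier S; c \<in> carrier S; is_join S j {a, b}\<rbrakk>
        \<Longrightarrow> is_join S (c \<otimes> j) {c \<otimes> a, c \<otimes> b}"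
    and join_distrib_right:
      "\<lbrakk>a \<in> carrier S; b \<in> carrier S; c \<in> carrier S; is_join S j {a, b}\<rbrakk>
        \<Longrightarrow> is_join S (j \<otimes> c) {a \<otimes> c, b \<otimes> c}"

locale boolean_lattice = lattice +
  assumes ex_least: "\<exists>x. least L x (carrier L)"
    and ex_greatest: "\<exists>x. greatest L x (carrier L)"
    and meet_join_distrib:
      "\<lbrakk>x \<in> carrier L; y \<in> carrier L; z \<in> carrier L\<rbrakk>
        \<Longrightarrow> x \<sqinter> (y \<squnion> z) = (x \<sqinter> y) \<squnion> (x \<sqinter> z)"
    and ex_complement:
      "x \<in> carrier L \<Longrightarrow> \<exists>y \<in> carrier L. x \<sqinter> y = \<bottom> \<and> x \<squnion> y = \<top>"

locale boolean_inverse_monoid = distributive_inverse_monoid +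
  assumes boolean_idempotents: "boolean_lattice (idempotent_order S)"

locale boolean_inverse_meet_monoid = boolean_inverse_monoid +
  assumes ex_meet: "\<lbrakk>a \<in> carrier S; b \<in> carrier S\<rbrakk> \<Longrightarrow> \<exists>m. is_meet S m {a, b}"

definition infinitesimals :: "('a, 'b) monoid_scheme \<Rightarrow> 'a set" where
  "infinitesimals S = {s \<in> carrier S. s \<noteq> szero S \<and> s \<otimes>\<^bsub>S\<^esub> s = szero S}"

definition basic :: "('a, 'b) monoid_scheme \<Rightarrow> bool" where
  "basic S \<longleftrightarrow>
     (\<forall>a \<in> carrier S. a \<noteq> szero S \<longrightarrow>
       (\<exists>I e. finite I \<and> I \<subseteq> infinitesimals S \<and> e \<in> idempotents S \<and> is_join S a (insert e I)))"

section \<open>Topological groupoids\<close>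

text \<open>The product \<open>gcomp G g h\<close> is meaningful only when \<open>gdom G g = gran G h\<close>.\<close>

record 'g top_groupoid =
  arrows :: "'g set"
  gdom :: "'g \<Rightarrow> 'g"
  gran :: "'g \<Rightarrow> 'g"
  gcomp :: "'g \<Rightarrow> 'g \<Rightarrow> 'g"
  ginv :: "'g \<Rightarrow> 'g"
  gtop :: "'g topology"

definition identities :: "('g, 'm) top_groupoid_scheme \<Rightarrow> 'g set" where
  "identities G = gdom G ` arrows G"

definition principal_groupoid :: "('g, 'm) top_groupoid_scheme \<Rightarrow> bool" where
  "principal_groupoid G \<longleftrightarrow>
     {g \<in> arrows G. gcomp G (ginv G g) g = gcomp G g (ginv G g)} \<subseteq> identities G"

section \<open>The groupoid of ultrafilters\<close>

text \<open>Meets are required to exist in the filter; as they are unique, this agrees with closure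
  under meets whenever all binary meets exist.\<close>

definition proper_filter :: "('a, 'b) monoid_scheme \<Rightarrow> 'a set \<Rightarrow> bool" where
  "proper_filter S A \<longleftrightarrow>
     A \<subseteq> carrier S \<and> A \<noteq> {} \<and> szero S \<notin> A \<and>
     (\<forall>a \<in> A. \<forall>b \<in> A. \<exists>m \<in> A. is_meet S m {a, b}) \<and>
     (\<forall>a \<in> A. \<forall>b \<in> carrier S. a \<sqsubseteq>\<^bsub>natural_order S\<^esub> b \<longrightarrow> b \<in> A)"

definition ultrafilters :: "('a, 'b) monoid_scheme \<Rightarrow> 'a set set" where
  "ultrafilters S =
     {A. proper_filter S A \<and> (\<forall>B. proper_filter S B \<and> A \<subseteq> B \<longrightarrow> B = A)}"

definition up_closure :: "('a, 'b) monoid_scheme \<Rightarrow> 'a set \<Rightarrow> 'a set" where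
  "up_closure S A = {b \<in> carrier S. \<exists>a \<in> A. a \<sqsubseteq>\<^bsub>natural_order S\<^esub> b}"

definition uf_dom :: "('a, 'b) monoid_scheme \<Rightarrow> 'a set \<Rightarrow> 'a set" where
  "uf_dom S A = up_closure S ((sinv S ` A) <#>\<^bsub>S\<^esub> A)"

definition uf_ran :: "('a, 'b) monoid_scheme \<Rightarrow> 'a set \<Rightarrow> 'a set" where
  "uf_ran S A = up_closure S (A <#>\<^bsub>S\<^esub> (sinv S ` A))"

definition uf_comp :: "('a, 'b) monoid_scheme \<Rightarrow> 'a set \<Rightarrow> 'a set \<Rightarrow> 'a set" where
  "uf_comp S A B =
     (if uf_dom S A = uf_ran S B then up_closure S (A <#>\<^bsub>S\<^esub> B) else undefined)"

definition uf_basic_open :: "('a, 'b) monoid_scheme \<Rightarrow> 'a \<Rightarrow> 'a set set" where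
  "uf_basic_open S a = {A \<in> ultrafilters S. a \<in> A}"

definition ultrafilter_groupoid :: "('a, 'b) monoid_scheme \<Rightarrow> 'a set top_groupoid" where
  "ultrafilter_groupoid S =
     \<lparr>arrows = ultrafilters S,
      gdom = uf_dom S,
      gran = uf_ran S,
      gcomp = uf_comp S,
      ginv = (\<lambda>A. sinv S ` A),
      gtop = topology_generated_by (uf_basic_open S ` carrier S)\<rparr>"

end

theory Submission
  imports Defs
begin

text \<open>Write \<open>d(A)\<close> and \<open>r(A)\<close> for the domain and range of an ultrafilter \<open>A\<close>. Since
  \<open>A\<^sup>-\<^sup>1 \<cdot> A = d(A)\<close> and \<open>A \<cdot> A\<^sup>-\<^sup>1 = r(A)\<close>, principality says that every ultrafilter
  with \<open>d(A) = r(A)\<close> is an identity. The proof reads both notions off the elements of \<open>A\<close>: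

  \<^item> \<open>A\<close> is an identity exactly when it contains an idempotent (\<open>identity_if_idem\<close> and
    \<open>idem_in_identity\<close>);

  \<^item> \<open>d(A) \<noteq> r(A)\<close> exactly when \<open>A\<close> contains an infinitesimal (\<open>infinitesimal_separates\<close>
    and \<open>dom_eq_ran_if_no_infinitesimal\<close>). If \<open>s\<^sup>2 = 0\<close> then \<open>s\<^sup>-\<^sup>1s\<close> and \<open>ss\<^sup>-\<^sup>1\<close> are
    orthogonal, so they cannot lie in one proper filter. Conversely, for \<open>c \<in> A\<close> and \<open>k\<close> the
    complement of \<open>e = c\<^sup>-\<^sup>1c\<close>, the element \<open>c\<close> is the join of \<open>ec\<close> and \<open>kc\<close>; the part \<open>kc\<close>
    squares to zero, so \<open>ec \<in> A\<close> if \<open>A\<close> has no infinitesimal, and then \<open>e \<in> r(A)\<close>.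

  Hence the groupoid is principal exactly when every ultrafilter contains an idempotent or an
  infinitesimal, and it remains to compare this with \<open>S\<close> being basic. If \<open>S\<close> is basic, an element
  of \<open>A\<close> is a finite join of such elements, and one of them lies in \<open>A\<close> because ultrafilters are
  prime (\<open>ultrafilter_prime\<close>). In the other direction, the basic open set \<open>V\<^sub>a\<close> is covered by
  the sets \<open>V\<^sub>b\<close> with \<open>b \<le> a\<close> infinitesimal or \<open>b = a \<and> 1\<close>, where \<open>a \<and> 1\<close> is the largest
  idempotent below \<open>a\<close>. Compactness of \<open>V\<^sub>a\<close> extracts a finite subfamily, whose join is \<open>a\<close>.
  The lemma \<open>ex_ultrafilter_avoiding\<close> is this compactness statement in contrapositive form.\<close>

section \<open>Inverse monoids and their natural order\<close>

context inverse_monoid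
begin

abbreviation star ("_\<^sup>\<star>" [1000] 999) where "s\<^sup>\<star> \<equiv> sinv S s"

abbreviation zero ("\<zero>") where "\<zero> \<equiv> szero S"

abbreviation nle (infix "\<preceq>" 50) where "s \<preceq> t \<equiv> s \<sqsubseteq>\<^bsub>natural_order S\<^esub> t"

lemma inverse_of_sinv: "s \<in> carrier S \<Longrightarrow> inverse_of S s (s\<^sup>\<star>)"
  unfolding sinv_def by (rule theI') (rule ex1_inverse)

lemma sinv_closed [simp, intro]: "s \<in> carrier S \<Longrightarrow> s\<^sup>\<star> \<in> carrier S"
  using inverse_of_sinv by (simp add: inverse_of_def)

lemma mult_sinv_mult: "s \<in> carrier S \<Longrightarrow> s \<otimes> (s\<^sup>\<star> \<otimes> s) = s"
  using inverse_of_sinv [of s] by (simp add: inverse_of_def m_assoc)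

lemma sinv_mult_sinv: "s \<in> carrier S \<Longrightarrow> s\<^sup>\<star> \<otimes> (s \<otimes> s\<^sup>\<star>) = s\<^sup>\<star>"
  using inverse_of_sinv [of s] by (simp add: inverse_of_def m_assoc)

lemma sinv_eqI:
  assumes "s \<in> carrier S" "t \<in> carrier S" "s \<otimes> (t \<otimes> s) = s" "t \<otimes> (s \<otimes> t) = t"
  shows "s\<^sup>\<star> = t"
proof -
  have "inverse_of S s t" using assms by (simp add: inverse_of_def m_assoc)
  then show ?thesis using ex1_inverse [OF assms(1)] inverse_of_sinv [OF assms(1)] by blast
qed

lemma sinv_sinv [simp]: "s \<in> carrier S \<Longrightarrow> (s\<^sup>\<star>)\<^sup>\<star> = s"
  by (rule sinv_eqI) (simp_all add: mult_sinv_mult sinv_mult_sinv)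

lemma is_zero_zero: "is_zero S \<zero>"
proof -
  have "y = z" if "is_zero S y" "is_zero S z" for y z
  proof -
    have "y \<otimes> z = y" using that unfolding is_zero_def by blast
    moreover have "y \<otimes> z = z" using that unfolding is_zero_def by blast
    ultimately show ?thesis by (rule subst)
  qed
  then have "\<exists>!z. is_zero S z" using ex_zero by blast
  then show ?thesis unfolding szero_def by (rule theI')
qed

lemma zero_closed [simp, intro]: "\<zero> \<in> carrier S"
  and zero_mult [simp]: "s \<in> carrier S \<Longrightarrow> \<zero> \<otimes> s = \<zero>"
  and mult_zero [simp]: "s \<in> carrier S \<Longrightarrow> s \<otimes> \<zero> = \<zero>"
  using is_zero_zero by (simp_all add: is_zero_def)

lemma idem_idem: "e \<in> idempotents S \<Longrightarrow> e \<otimes> e = e"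
  and idempotentI: "e \<in> carrier S \<Longrightarrow> e \<otimes> e = e \<Longrightarrow> e \<in> idempotents S"
  and idempotents_closed [simp]: "e \<in> idempotents S \<Longrightarrow> e \<in> carrier S"
  by (simp_all add: idempotents_def)

lemma idem_idem_left: "e \<in> idempotents S \<Longrightarrow> x \<in> carrier S \<Longrightarrow> e \<otimes> (e \<otimes> x) = e \<otimes> x"
  by (metis idem_idem idempotents_closed m_assoc)

lemma sinv_idem [simp]: "e \<in> idempotents S \<Longrightarrow> e\<^sup>\<star> = e"
  by (rule sinv_eqI) (simp_all add: idem_idem)

lemma zero_idempotent [simp]: "\<zero> \<in> idempotents S"
  and one_idempotent [simp]: "\<one> \<in> idempotents S"
  by (auto intro!: idempotentI)

text \<open>If \<open>x\<close> is the inverse of \<open>ef\<close>, then so is \<open>fxe\<close>. Uniqueness gives \<open>x = fxe\<close>, which makes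
  \<open>x\<close> idempotent; an idempotent is its own inverse, so \<open>ef = x\<close>.\<close>

lemma idem_mult [simp, intro]:
  assumes "e \<in> idempotents S" "f \<in> idempotents S"
  shows "e \<otimes> f \<in> idempotents S"
proof -
  let ?x = "(e \<otimes> f)\<^sup>\<star>"
  note [simp] = m_assoc idem_idem idem_idem_left
  have c [simp]: "e \<in> carrier S" "f \<in> carrier S" "?x \<in> carrier S" using assms by auto
  have 1: "e \<otimes> (f \<otimes> (?x \<otimes> (e \<otimes> f))) = e \<otimes> f"
    using mult_sinv_mult [of "e \<otimes> f"] by simp
  have 2: "?x \<otimes> (e \<otimes> (f \<otimes> ?x)) = ?x"
    using sinv_mult_sinv [of "e \<otimes> f"] by simp
  have absorb: "?x \<otimes> (e \<otimes> (f \<otimes> (?x \<otimes> y))) = ?x \<otimes> y" if "y \<in> carrier S" for y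
  proof -
    have "?x \<otimes> (e \<otimes> (f \<otimes> ?x)) \<otimes> y = ?x \<otimes> y" by (simp only: 2)
    then show ?thesis using that by simp
  qed
  have x: "?x = f \<otimes> (?x \<otimes> e)"
    by (rule sinv_eqI) (use assms 1 absorb in simp_all)
  have "?x \<otimes> ?x = (f \<otimes> (?x \<otimes> e)) \<otimes> (f \<otimes> (?x \<otimes> e))" using x by simp
  also have "\<dots> = f \<otimes> (?x \<otimes> e)" using assms by (simp add: absorb)
  also have "\<dots> = ?x" using x by simp
  finally have "?x \<in> idempotents S" by (intro idempotentI) simp_all
  then have "?x\<^sup>\<star> = ?x" by (rule sinv_idem)
  then have "e \<otimes> f = ?x" by simp
  then show ?thesis using \<open>?x \<in> idempotents S\<close> by simp
qed

text \<open>As products of idempotents are idempotent, \<open>fe\<close> is an inverse of \<open>ef\<close>, and so is \<open>ef\<close>.\<close>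

lemma idem_comm:
  assumes "e \<in> idempotents S" "f \<in> idempotents S"
  shows "e \<otimes> f = f \<otimes> e"
proof -
  note [simp] = m_assoc idem_idem idem_idem_left
  have c [simp]: "e \<in> carrier S" "f \<in> carrier S" using assms by auto
  have a: "e \<otimes> (f \<otimes> (e \<otimes> f)) = e \<otimes> f" using idem_idem [OF idem_mult [OF assms]] by simp
  have b: "f \<otimes> (e \<otimes> (f \<otimes> e)) = f \<otimes> e" using idem_idem [OF idem_mult [OF assms(2,1)]] by simp
  have "(e \<otimes> f)\<^sup>\<star> = f \<otimes> e"
    by (rule sinv_eqI) (use assms a b in simp_all)
  then show ?thesis using assms by simp
qed

lemma sinv_mult_idem [simp, intro]: "s \<in> carrier S \<Longrightarrow> s\<^sup>\<star> \<otimes> s \<in> idempotents S"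
  and mult_sinv_idem [simp, intro]: "s \<in> carrier S \<Longrightarrow> s \<otimes> s\<^sup>\<star> \<in> idempotents S"
  by (auto intro!: idempotentI simp: m_assoc mult_sinv_mult sinv_mult_sinv)

lemma sinv_mult:
  assumes [simp]: "s \<in> carrier S" "t \<in> carrier S"
  shows "(s \<otimes> t)\<^sup>\<star> = t\<^sup>\<star> \<otimes> s\<^sup>\<star>"
proof (rule sinv_eqI)
  have comm: "t \<otimes> t\<^sup>\<star> \<otimes> (s\<^sup>\<star> \<otimes> s) = s\<^sup>\<star> \<otimes> s \<otimes> (t \<otimes> t\<^sup>\<star>)" by (rule idem_comm) simp_all
  have "s \<otimes> t \<otimes> (t\<^sup>\<star> \<otimes> s\<^sup>\<star> \<otimes> (s \<otimes> t)) = s \<otimes> (t \<otimes> t\<^sup>\<star> \<otimes> (s\<^sup>\<star> \<otimes> s)) \<otimes> t"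
    by (simp add: m_assoc)
  also have "\<dots> = s \<otimes> (s\<^sup>\<star> \<otimes> s) \<otimes> (t \<otimes> (t\<^sup>\<star> \<otimes> t))" by (simp only: comm) (simp add: m_assoc)
  also have "\<dots> = s \<otimes> t" by (simp add: mult_sinv_mult)
  finally show "s \<otimes> t \<otimes> (t\<^sup>\<star> \<otimes> s\<^sup>\<star> \<otimes> (s \<otimes> t)) = s \<otimes> t" .
  have "t\<^sup>\<star> \<otimes> s\<^sup>\<star> \<otimes> (s \<otimes> t \<otimes> (t\<^sup>\<star> \<otimes> s\<^sup>\<star>)) = t\<^sup>\<star> \<otimes> (s\<^sup>\<star> \<otimes> s \<otimes> (t \<otimes> t\<^sup>\<star>)) \<otimes> s\<^sup>\<star>"
    by (simp add: m_assoc)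
  also have "\<dots> = t\<^sup>\<star> \<otimes> (t \<otimes> t\<^sup>\<star>) \<otimes> (s\<^sup>\<star> \<otimes> (s \<otimes> s\<^sup>\<star>))"
    by (simp only: comm [symmetric]) (simp add: m_assoc)
  also have "\<dots> = t\<^sup>\<star> \<otimes> s\<^sup>\<star>" by (simp add: sinv_mult_sinv)
  finally show "t\<^sup>\<star> \<otimes> s\<^sup>\<star> \<otimes> (s \<otimes> t \<otimes> (t\<^sup>\<star> \<otimes> s\<^sup>\<star>)) = t\<^sup>\<star> \<otimes> s\<^sup>\<star>" .
qed simp_all

text \<open>An idempotent on the right of \<open>s\<close> can be moved to the left at the price of conjugation. This makes
  the natural order, which is defined by right multiplication, symmetric between left and right.\<close>

lemma conj_idem:
  assumes [simp]: "s \<in> carrier S" "e \<in> idempotents S"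
  shows "s \<otimes> e \<otimes> s\<^sup>\<star> \<in> idempotents S"
    and mult_idem_swap: "s \<otimes> e = (s \<otimes> e \<otimes> s\<^sup>\<star>) \<otimes> s"
proof -
  have "s \<otimes> e \<otimes> s\<^sup>\<star> = (s \<otimes> e) \<otimes> (s \<otimes> e)\<^sup>\<star>"
    by (simp add: sinv_mult m_assoc idem_idem_left)
  then show "s \<otimes> e \<otimes> s\<^sup>\<star> \<in> idempotents S" by simp
  have "s \<otimes> e \<otimes> s\<^sup>\<star> \<otimes> s = s \<otimes> (e \<otimes> (s\<^sup>\<star> \<otimes> s))" by (simp add: m_assoc)
  also have "\<dots> = s \<otimes> (s\<^sup>\<star> \<otimes> s) \<otimes> e" by (subst idem_comm) (simp_all add: m_assoc)
  finally show "s \<otimes> e = (s \<otimes> e \<otimes> s\<^sup>\<star>) \<otimes> s" by (simp add: mult_sinv_mult)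
qed

lemma le_iff_dom: "s \<in> carrier S \<Longrightarrow> t \<in> carrier S \<Longrightarrow> s \<preceq> t \<longleftrightarrow> s = t \<otimes> (s\<^sup>\<star> \<otimes> s)"
  by (simp add: natural_order_def m_assoc)

lemma mult_idem_le:
  assumes [simp]: "t \<in> carrier S" "e \<in> idempotents S"
  shows "t \<otimes> e \<preceq> t"
proof -
  have "t \<otimes> ((t \<otimes> e)\<^sup>\<star> \<otimes> (t \<otimes> e)) = t \<otimes> (e \<otimes> (t\<^sup>\<star> \<otimes> t) \<otimes> e)"
    by (simp add: sinv_mult m_assoc)
  also have "\<dots> = t \<otimes> ((t\<^sup>\<star> \<otimes> t) \<otimes> e \<otimes> e)" by (subst idem_comm) simp_all
  also have "\<dots> = t \<otimes> (t\<^sup>\<star> \<otimes> t) \<otimes> e" by (simp add: m_assoc idem_idem)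
  finally show ?thesis by (simp add: le_iff_dom mult_sinv_mult)
qed

lemma le_iff_ex_idem_right:
  assumes "s \<in> carrier S" "t \<in> carrier S"
  shows "s \<preceq> t \<longleftrightarrow> (\<exists>e \<in> idempotents S. s = t \<otimes> e)"
  using assms le_iff_dom mult_idem_le sinv_mult_idem by metis

lemma idem_mult_le:
  assumes [simp]: "t \<in> carrier S" "e \<in> idempotents S"
  shows "e \<otimes> t \<preceq> t"
  using mult_idem_swap [of "t\<^sup>\<star>" e] conj_idem [of "t\<^sup>\<star>" e]
  by (metis assms(1) assms(2) idempotents_closed m_closed mult_idem_le sinv_closed sinv_idem
      sinv_mult sinv_sinv)

lemma le_iff_ex_idem_left:
  assumes "s \<in> carrier S" "t \<in> carrier S"
  shows "s \<preceq> t \<longleftrightarrow> (\<exists>e \<in> idempotents S. s = e \<otimes> t)"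
  using assms conj_idem mult_idem_swap le_iff_ex_idem_right idem_mult_le by metis

lemma le_refl [simp]: "s \<in> carrier S \<Longrightarrow> s \<preceq> s"
  by (simp add: le_iff_dom mult_sinv_mult)

lemma le_trans [trans]:
  assumes "s \<preceq> t" "t \<preceq> u" and c: "s \<in> carrier S" "t \<in> carrier S" "u \<in> carrier S"
  shows "s \<preceq> u"
proof -
  obtain e f where "e \<in> idempotents S" "f \<in> idempotents S" "s = t \<otimes> e" "t = u \<otimes> f"
    using assms le_iff_ex_idem_right by metis
  then have "s = u \<otimes> (f \<otimes> e)" "f \<otimes> e \<in> idempotents S" using c by (simp_all add: m_assoc)
  then show ?thesis using c mult_idem_le by metis
qed

lemma le_antisym:
  assumes "s \<preceq> t" "t \<preceq> s" and c: "s \<in> carrier S" "t \<in> carrier S"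
  shows "s = t"
proof -
  let ?f = "s\<^sup>\<star> \<otimes> s" and ?g = "t\<^sup>\<star> \<otimes> t"
  have s: "s = t \<otimes> ?f" and t: "t = s \<otimes> ?g" using assms le_iff_dom by auto
  have "t = t \<otimes> ?f \<otimes> ?g" using s t by simp
  also have "\<dots> = t \<otimes> (?f \<otimes> ?g)" using c by (simp add: m_assoc)
  also have "\<dots> = t \<otimes> (?g \<otimes> ?f)" using c idem_comm by simp
  also have "\<dots> = t \<otimes> ?g \<otimes> ?f" using c by (simp add: m_assoc)
  also have "\<dots> = s" using s c mult_sinv_mult by simp
  finally show ?thesis by simp
qed

lemma le_mult_left:
  assumes "s \<preceq> t" and c: "s \<in> carrier S" "t \<in> carrier S" "u \<in> carrier S"
  shows "u \<otimes> s \<preceq> u \<otimes> t"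
proof -
  obtain e where "e \<in> idempotents S" "s = t \<otimes> e" using assms le_iff_ex_idem_right by metis
  then show ?thesis using c mult_idem_le [of "u \<otimes> t" e] by (simp add: m_assoc)
qed

lemma le_mult_right:
  assumes "s \<preceq> t" and c: "s \<in> carrier S" "t \<in> carrier S" "u \<in> carrier S"
  shows "s \<otimes> u \<preceq> t \<otimes> u"
proof -
  obtain e where "e \<in> idempotents S" "s = e \<otimes> t" using assms le_iff_ex_idem_left by metis
  then show ?thesis using c idem_mult_le [of "t \<otimes> u" e] by (simp add: m_assoc)
qed

lemma le_mult:
  assumes "s \<preceq> t" "u \<preceq> v"
    and "s \<in> carrier S" "t \<in> carrier S" "u \<in> carrier S" "v \<in> carrier S"
  shows "s \<otimes> u \<preceq> t \<otimes> v"
  using assms le_mult_left [of u v s] le_mult_right [of s t v] le_trans m_closed by metis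

lemma le_sinv:
  assumes "s \<preceq> t" and c: "s \<in> carrier S" "t \<in> carrier S"
  shows "s\<^sup>\<star> \<preceq> t\<^sup>\<star>"
proof -
  obtain e where "e \<in> idempotents S" "s = t \<otimes> e" using assms le_iff_ex_idem_right by metis
  then show ?thesis using c idem_mult_le by (simp add: sinv_mult)
qed

lemma le_idem_iff:
  "e \<in> idempotents S \<Longrightarrow> f \<in> idempotents S \<Longrightarrow> e \<preceq> f \<longleftrightarrow> e \<otimes> f = e"
  using le_iff_dom [of e f] idem_comm [of e f] by (auto simp: idem_idem)

lemma le_idem:
  "s \<preceq> e \<Longrightarrow> s \<in> carrier S \<Longrightarrow> e \<in> idempotents S \<Longrightarrow> s \<in> idempotents S"
  using le_iff_ex_idem_right [of s e] by auto

lemma le_zero: "s \<preceq> \<zero> \<Longrightarrow> s \<in> carrier S \<Longrightarrow> s = \<zero>"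
  using le_iff_ex_idem_right [of s \<zero>] by auto

lemma zero_if_dom_zero: "s \<in> carrier S \<Longrightarrow> s\<^sup>\<star> \<otimes> s = \<zero> \<Longrightarrow> s = \<zero>"
  using mult_sinv_mult [of s] by simp

lemma dom_mono:
  assumes "s \<preceq> t" "s \<in> carrier S" "t \<in> carrier S"
  shows "s\<^sup>\<star> \<otimes> s \<preceq> t\<^sup>\<star> \<otimes> t"
  using assms by (simp add: le_mult le_sinv)

lemma is_meet_iff:
  assumes "a \<in> carrier S" "b \<in> carrier S"
  shows "is_meet S m {a, b} \<longleftrightarrow>
    m \<in> carrier S \<and> m \<preceq> a \<and> m \<preceq> b \<and> (\<forall>x \<in> carrier S. x \<preceq> a \<longrightarrow> x \<preceq> b \<longrightarrow> x \<preceq> m)"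
proof -
  have "carrier (natural_order S) = carrier S" by (simp add: natural_order_def)
  then show ?thesis using assms unfolding is_meet_def greatest_def Lower_def by auto
qed

lemma is_join_iff:
  assumes "X \<subseteq> carrier S"
  shows "is_join S j X \<longleftrightarrow>
    j \<in> carrier S \<and> (\<forall>x \<in> X. x \<preceq> j) \<and> (\<forall>u \<in> carrier S. (\<forall>x \<in> X. x \<preceq> u) \<longrightarrow> j \<preceq> u)"
proof -
  have c: "carrier (natural_order S) = carrier S" by (simp add: natural_order_def)
  have "Upper (natural_order S) X = {u \<in> carrier S. \<forall>x \<in> X. x \<preceq> u}"
    using assms unfolding Upper_def c by auto
  then show ?thesis unfolding is_join_def least_def c by auto
qed

section \<open>Filters and the groupoid operations\<close>

lemma proper_filterD:
  assumes "proper_filter S A"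
  shows proper_filter_closed: "a \<in> A \<Longrightarrow> a \<in> carrier S"
    and proper_filter_nonempty: "A \<noteq> {}"
    and proper_filter_zero: "\<zero> \<notin> A"
    and proper_filter_up: "a \<in> A \<Longrightarrow> a \<preceq> b \<Longrightarrow> b \<in> carrier S \<Longrightarrow> b \<in> A"
  using assms unfolding proper_filter_def by auto

lemma proper_filter_directed:
  assumes "proper_filter S A" "a \<in> A" "b \<in> A"
  obtains c where "c \<in> A" "c \<preceq> a" "c \<preceq> b"
proof -
  obtain m where "m \<in> A" "is_meet S m {a, b}" using assms unfolding proper_filter_def by blast
  then show ?thesis using that is_meet_iff assms proper_filter_closed by metis
qed

lemma ultrafilter_proper: "A \<in> ultrafilters S \<Longrightarrow> proper_filter S A"
  by (simp add: ultrafilters_def)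

lemma ultrafilter_maximal: "A \<in> ultrafilters S \<Longrightarrow> proper_filter S B \<Longrightarrow> A \<subseteq> B \<Longrightarrow> B = A"
  by (simp add: ultrafilters_def)

text \<open>The upward closure of \<open>A\<^sup>-\<^sup>1A\<close> is formed from products \<open>a\<^sup>-\<^sup>1b\<close> of two different elements,
  but a common lower bound \<open>c\<close> of \<open>a\<close> and \<open>b\<close> in \<open>A\<close> gives \<open>c\<^sup>-\<^sup>1c \<le> a\<^sup>-\<^sup>1b\<close>. Hence domains
  and ranges are generated by idempotents.\<close>

lemma mem_uf_dom_iff:
  assumes "proper_filter S A"
  shows "x \<in> uf_dom S A \<longleftrightarrow> x \<in> carrier S \<and> (\<exists>c \<in> A. c\<^sup>\<star> \<otimes> c \<preceq> x)"
proof (intro iffI conjI)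
  assume "x \<in> uf_dom S A"
  then obtain a b where x: "x \<in> carrier S" and ab: "a \<in> A" "b \<in> A" "a\<^sup>\<star> \<otimes> b \<preceq> x"
    unfolding uf_dom_def up_closure_def set_mult_def by auto
  obtain c where c: "c \<in> A" "c \<preceq> a" "c \<preceq> b" using proper_filter_directed assms ab by metis
  have cl: "a \<in> carrier S" "b \<in> carrier S" "c \<in> carrier S"
    using assms ab c proper_filter_closed by auto
  have "c\<^sup>\<star> \<otimes> c \<preceq> a\<^sup>\<star> \<otimes> b" using c cl by (simp add: le_mult le_sinv)
  then have "c\<^sup>\<star> \<otimes> c \<preceq> x" using ab(3) x cl by (meson le_trans m_closed sinv_closed)
  then show "\<exists>c \<in> A. c\<^sup>\<star> \<otimes> c \<preceq> x" using c by blast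
  show "x \<in> carrier S" by (rule x)
qed (auto simp: uf_dom_def up_closure_def set_mult_def)

lemma mem_uf_ran_iff:
  assumes "proper_filter S A"
  shows "x \<in> uf_ran S A \<longleftrightarrow> x \<in> carrier S \<and> (\<exists>c \<in> A. c \<otimes> c\<^sup>\<star> \<preceq> x)"
proof (intro iffI conjI)
  assume "x \<in> uf_ran S A"
  then obtain a b where x: "x \<in> carrier S" and ab: "a \<in> A" "b \<in> A" "a \<otimes> b\<^sup>\<star> \<preceq> x"
    unfolding uf_ran_def up_closure_def set_mult_def by auto
  obtain c where c: "c \<in> A" "c \<preceq> a" "c \<preceq> b" using proper_filter_directed assms ab by metis
  have cl: "a \<in> carrier S" "b \<in> carrier S" "c \<in> carrier S"
    using assms ab c proper_filter_closed by auto
  have "c \<otimes> c\<^sup>\<star> \<preceq> a \<otimes> b\<^sup>\<star>" using c cl by (simp add: le_mult le_sinv)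
  then have "c \<otimes> c\<^sup>\<star> \<preceq> x" using ab(3) x cl by (meson le_trans m_closed sinv_closed)
  then show "\<exists>c \<in> A. c \<otimes> c\<^sup>\<star> \<preceq> x" using c by blast
  show "x \<in> carrier S" by (rule x)
qed (auto simp: uf_ran_def up_closure_def set_mult_def)

lemma isotropy_iff_dom_eq_ran:
  assumes "A \<in> ultrafilters S"
  shows "uf_comp S (sinv S ` A) A = uf_comp S A (sinv S ` A) \<longleftrightarrow> uf_dom S A = uf_ran S A"
proof -
  have "sinv S ` sinv S ` A = A"
    using proper_filter_closed [OF ultrafilter_proper [OF assms]] by (force simp: image_image)
  then have "uf_dom S (sinv S ` A) = uf_ran S A" "uf_ran S (sinv S ` A) = uf_dom S A"
    by (simp_all add: uf_dom_def uf_ran_def)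
  then show ?thesis by (simp add: uf_comp_def uf_dom_def uf_ran_def)
qed

lemma principal_iff:
  "principal_groupoid (ultrafilter_groupoid S) \<longleftrightarrow>
    (\<forall>A \<in> ultrafilters S. uf_dom S A = uf_ran S A \<longrightarrow> A \<in> uf_dom S ` ultrafilters S)"
proof -
  have "{A \<in> ultrafilters S. uf_comp S (sinv S ` A) A = uf_comp S A (sinv S ` A)} =
      {A \<in> ultrafilters S. uf_dom S A = uf_ran S A}"
    using isotropy_iff_dom_eq_ran by blast
  then show ?thesis
    unfolding principal_groupoid_def ultrafilter_groupoid_def identities_def by auto
qed

lemma idem_in_identity:
  assumes "B \<in> ultrafilters S"
  obtains e where "e \<in> idempotents S" "e \<in> uf_dom S B"
proof -
  have B: "proper_filter S B" by (rule ultrafilter_proper [OF assms])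
  then obtain b where b: "b \<in> B" using proper_filter_nonempty by blast
  then have "b \<in> carrier S" using B proper_filter_closed by blast
  then have "b\<^sup>\<star> \<otimes> b \<in> uf_dom S B"
    unfolding mem_uf_dom_iff [OF B] using b by (auto intro!: bexI [of _ b])
  then show ?thesis using that [of "b\<^sup>\<star> \<otimes> b"] \<open>b \<in> carrier S\<close> by simp
qed

text \<open>Below an idempotent there are only idempotents, so \<open>A\<close> is generated by its idempotents, and these
  satisfy \<open>c\<^sup>-\<^sup>1c = c\<close>.\<close>

lemma identity_if_idem:
  assumes A: "A \<in> ultrafilters S" and e: "e \<in> A" "e \<in> idempotents S"
  shows "uf_dom S A = A"
proof (intro Set.set_eqI iffI)
  have pf: "proper_filter S A" by (rule ultrafilter_proper [OF A])
  have below: "\<exists>c \<in> A. c \<in> idempotents S \<and> c \<preceq> a" if "a \<in> A" for a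
    using that e pf proper_filter_directed le_idem proper_filter_closed by metis
  fix x
  show "x \<in> uf_dom S A" if x: "x \<in> A"
  proof -
    obtain c where c: "c \<in> A" "c \<in> idempotents S" "c \<preceq> x" using below x by blast
    then have "c\<^sup>\<star> \<otimes> c \<preceq> x" by (simp add: idem_idem)
    then show ?thesis using c x pf mem_uf_dom_iff proper_filter_closed by metis
  qed
  show "x \<in> A" if x: "x \<in> uf_dom S A"
  proof -
    obtain a where a: "a \<in> A" "a\<^sup>\<star> \<otimes> a \<preceq> x" and xc: "x \<in> carrier S"
      using x pf mem_uf_dom_iff by blast
    obtain c where c: "c \<in> A" "c \<in> idempotents S" "c \<preceq> a" using below a by blast
    have cl: "a \<in> carrier S" "c \<in> carrier S" using a c pf proper_filter_closed by auto
    have "c \<preceq> a\<^sup>\<star> \<otimes> a" using dom_mono [of c a] c cl by (simp add: idem_idem)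
    then have "c \<preceq> x" using a(2) cl xc le_trans m_closed sinv_closed by metis
    then show "x \<in> A" using pf c xc proper_filter_up by metis
  qed
qed

text \<open>The idempotents \<open>s\<^sup>-\<^sup>1s\<close> and \<open>ss\<^sup>-\<^sup>1\<close> lie in the domain and range of \<open>A\<close> and have product
  \<open>s\<^sup>-\<^sup>1s\<^sup>2s\<^sup>-\<^sup>1 = 0\<close>. If domain and range agreed, some \<open>c \<in> A\<close> would have \<open>c\<^sup>-\<^sup>1c\<close> below
  both, which forces \<open>c = 0\<close>.\<close>

lemma infinitesimal_separates:
  assumes A: "A \<in> ultrafilters S" and s: "s \<in> A" "s \<in> infinitesimals S"
  shows "uf_dom S A \<noteq> uf_ran S A"
proof
  assume eq: "uf_dom S A = uf_ran S A"
  have pf: "proper_filter S A" by (rule ultrafilter_proper [OF A])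
  have sc: "s \<in> carrier S" "s \<otimes> s = \<zero>" using s by (auto simp: infinitesimals_def)
  have "s \<otimes> s\<^sup>\<star> \<in> uf_ran S A"
    unfolding mem_uf_ran_iff [OF pf] using s sc by (auto intro!: bexI [of _ s])
  then have "s \<otimes> s\<^sup>\<star> \<in> uf_dom S A" using eq by simp
  then obtain b where b: "b \<in> A" "b\<^sup>\<star> \<otimes> b \<preceq> s \<otimes> s\<^sup>\<star>" using pf mem_uf_dom_iff by blast
  obtain c where c: "c \<in> A" "c \<preceq> s" "c \<preceq> b" using pf s b proper_filter_directed by metis
  have cl: "b \<in> carrier S" "c \<in> carrier S" using b c pf proper_filter_closed by auto
  let ?d = "c\<^sup>\<star> \<otimes> c"
  have "?d \<preceq> s\<^sup>\<star> \<otimes> s" using dom_mono c cl sc by blast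
  moreover have "?d \<preceq> s \<otimes> s\<^sup>\<star>"
    using dom_mono [of c b] c cl sc b(2) by (meson le_trans m_closed sinv_closed)
  ultimately have "?d \<otimes> ?d \<preceq> (s\<^sup>\<star> \<otimes> s) \<otimes> (s \<otimes> s\<^sup>\<star>)" using cl sc by (simp add: le_mult)
  also have "(s\<^sup>\<star> \<otimes> s) \<otimes> (s \<otimes> s\<^sup>\<star>) = s\<^sup>\<star> \<otimes> (s \<otimes> s) \<otimes> s\<^sup>\<star>" using sc(1) by (simp add: m_assoc)
  also have "\<dots> = \<zero>" using sc by simp
  finally have "?d = \<zero>" using cl le_zero by (simp add: idem_idem)
  then have "c = \<zero>" using cl zero_if_dom_zero by blast
  then show False using c pf proper_filter_zero by blast
qed

lemma proper_filter_Union_chain: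
  assumes "\<C> \<noteq> {}" "subset.chain {F. proper_filter S F} \<C>"
  shows "proper_filter S (\<Union>\<C>)"
proof -
  have F: "proper_filter S F" if "F \<in> \<C>" for F using that assms by (auto simp: subset_chain_def)
  have "\<exists>m \<in> \<Union>\<C>. is_meet S m {a, b}" if ab: "a \<in> \<Union>\<C>" "b \<in> \<Union>\<C>" for a b
  proof -
    obtain F G where "F \<in> \<C>" "G \<in> \<C>" "a \<in> F" "b \<in> G" using ab by blast
    then obtain H where "H \<in> \<C>" "a \<in> H" "b \<in> H"
      using assms(2) unfolding subset_chain_def by blast
    then show ?thesis using F [of H] unfolding proper_filter_def by blast
  qed
  moreover have "\<Union>\<C> \<subseteq> carrier S" "\<zero> \<notin> \<Union>\<C>"
    using F proper_filter_closed proper_filter_zero by blast+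
  moreover have "\<Union>\<C> \<noteq> {}" using assms(1) F proper_filter_nonempty by blast
  moreover have "b \<in> \<Union>\<C>" if "a \<in> \<Union>\<C>" "b \<in> carrier S" "a \<preceq> b" for a b
    using that F proper_filter_up by blast
  ultimately show ?thesis unfolding proper_filter_def by blast
qed

lemma ex_ultrafilter:
  assumes "proper_filter S B"
  obtains A where "A \<in> ultrafilters S" "B \<subseteq> A"
proof -
  let ?P = "{F. proper_filter S F \<and> B \<subseteq> F}"
  have "\<exists>M \<in> ?P. \<forall>X \<in> ?P. M \<subseteq> X \<longrightarrow> X = M"
  proof (rule subset_Zorn_nonempty)
    show "?P \<noteq> {}" using assms by blast
    fix \<C> assume ne: "\<C> \<noteq> {}" and ch: "subset.chain ?P \<C>"
    then have "proper_filter S (\<Union>\<C>)"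
      by (intro proper_filter_Union_chain) (auto simp: subset_chain_def)
    moreover have "B \<subseteq> \<Union>\<C>" using ne ch unfolding subset_chain_def by blast
    ultimately show "\<Union>\<C> \<in> ?P" by blast
  qed
  then obtain M where M: "M \<in> ?P" and max: "\<forall>X \<in> ?P. M \<subseteq> X \<longrightarrow> X = M" by (rule bexE)
  have "M \<in> ultrafilters S" unfolding ultrafilters_def using M max by auto
  then show ?thesis using that M by simp
qed

end

section \<open>Complements of idempotents\<close>

text \<open>In a distributive lattice a complement is a pseudocomplement: \<open>h\<close> is the join of its parts
  \<open>h \<sqinter> x\<close> and \<open>h \<sqinter> y\<close>, so it lies below either of \<open>x\<close> and \<open>y\<close> as soon as it is disjoint from
  the other.\<close>

lemma (in boolean_lattice) ex_complement_le:
  assumes x: "x \<in> carrier L"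
  shows "\<exists>y \<in> carrier L. x \<sqinter> y = \<bottom> \<and>
    (\<forall>h \<in> carrier L. (h \<sqinter> x = \<bottom> \<longrightarrow> h \<sqsubseteq> y) \<and> (h \<sqinter> y = \<bottom> \<longrightarrow> h \<sqsubseteq> x))"
proof -
  interpret weak_partial_order_bottom L by unfold_locales (rule ex_least)
  interpret weak_partial_order_top L by unfold_locales (rule ex_greatest)
  obtain y where y: "y \<in> carrier L" "x \<sqinter> y = \<bottom>" "x \<squnion> y = \<top>" using ex_complement x by blast
  have split: "h \<sqsubseteq> (h \<sqinter> x) \<squnion> (h \<sqinter> y)" if h: "h \<in> carrier L" for h
  proof -
    have "h \<sqsubseteq> h \<sqinter> \<top>" using h by (intro meet_le) (auto simp: top_higher)
    also have "h \<sqinter> \<top> = (h \<sqinter> x) \<squnion> (h \<sqinter> y)" using h x y meet_join_distrib by metis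
    finally show ?thesis .
  qed
  have bot: "\<bottom> \<squnion> z \<sqsubseteq> z" "z \<squnion> \<bottom> \<sqsubseteq> z" if "z \<in> carrier L" for z
    using that by (auto intro!: join_le bottom_lower)
  have "h \<sqsubseteq> y" if h: "h \<in> carrier L" "h \<sqinter> x = \<bottom>" for h
  proof -
    have "h \<sqsubseteq> h \<sqinter> y" using split [OF h(1)] bot(1) [of "h \<sqinter> y"] h y
      by (metis bottom_closed join_closed le_trans meet_closed)
    also have "h \<sqinter> y \<sqsubseteq> y" using h y by (simp add: meet_right)
    finally show ?thesis using h y by auto
  qed
  moreover have "h \<sqsubseteq> x" if h: "h \<in> carrier L" "h \<sqinter> y = \<bottom>" for h
  proof -
    have "h \<sqsubseteq> h \<sqinter> x" using split [OF h(1)] bot(2) [of "h \<sqinter> x"] h x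
      by (metis bottom_closed join_closed le_trans meet_closed)
    also have "h \<sqinter> x \<sqsubseteq> x" using h x by (simp add: meet_right)
    finally show ?thesis using h x by auto
  qed
  ultimately show ?thesis using y by blast
qed

context boolean_inverse_monoid
begin

text \<open>Complementation of idempotents expressed by products alone: \<open>h \<otimes> k = h\<close> is \<open>h \<le> k\<close>, and
  orthogonality is a zero product. In this form it combines directly with the products of \<open>S\<close>.\<close>

definition complementary :: "'a \<Rightarrow> 'a \<Rightarrow> bool" where
  "complementary e k \<longleftrightarrow> e \<in> idempotents S \<and> k \<in> idempotents S \<and> e \<otimes> k = \<zero> \<and>
    (\<forall>h \<in> idempotents S. (h \<otimes> e = \<zero> \<longrightarrow> h \<otimes> k = h) \<and> (h \<otimes> k = \<zero> \<longrightarrow> h \<otimes> e = h))"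

lemma complementaryD:
  assumes "complementary e k"
  shows "k \<in> idempotents S" "e \<otimes> k = \<zero>" "e \<in> idempotents S"
    and "\<And>h. h \<in> idempotents S \<Longrightarrow> h \<otimes> e = \<zero> \<Longrightarrow> h \<otimes> k = h"
    and "\<And>h. h \<in> idempotents S \<Longrightarrow> h \<otimes> k = \<zero> \<Longrightarrow> h \<otimes> e = h"
  using assms unfolding complementary_def by blast+

lemma ex_complementary:
  assumes e: "e \<in> idempotents S"
  shows "\<exists>k. complementary e k"
proof -
  interpret B: boolean_lattice "idempotent_order S" by (rule boolean_idempotents)
  let ?L = "idempotent_order S"
  have [simp]: "carrier ?L = idempotents S" by (simp add: idempotent_order_def)
  have le: "x \<sqsubseteq>\<^bsub>?L\<^esub> y \<longleftrightarrow> x = x \<otimes> y" for x y by (simp add: idempotent_order_def)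
  have meet: "x \<sqinter>\<^bsub>?L\<^esub> y = x \<otimes> y" if xy: "x \<in> idempotents S" "y \<in> idempotents S" for x y
  proof (rule B.le_antisym)
    let ?m = "x \<sqinter>\<^bsub>?L\<^esub> y"
    have m: "?m \<in> idempotents S" using B.meet_closed [of x y] xy by simp
    have "?m = ?m \<otimes> x" "?m = ?m \<otimes> y"
      using B.meet_left [of x y] B.meet_right [of x y] xy le by auto
    then have "?m = ?m \<otimes> (x \<otimes> y)" using m xy by (metis idempotents_closed m_assoc)
    then show "?m \<sqsubseteq>\<^bsub>?L\<^esub> x \<otimes> y" by (simp only: le)
    have "x \<otimes> y = (x \<otimes> y) \<otimes> y" using xy by (simp add: m_assoc idem_idem)
    moreover have "x \<otimes> y = (x \<otimes> y) \<otimes> x"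
      using xy idem_comm [of x y] by (simp add: m_assoc idem_idem)
    ultimately show "x \<otimes> y \<sqsubseteq>\<^bsub>?L\<^esub> ?m" using xy by (intro B.meet_le) (auto simp: le)
  qed (use xy B.meet_closed [of x y] in auto)
  have bot: "\<bottom>\<^bsub>?L\<^esub> = \<zero>"
  proof -
    obtain x where "least ?L x (idempotents S)" using B.ex_least by auto
    then have "least ?L \<bottom>\<^bsub>?L\<^esub> (idempotents S)"
      unfolding bottom_def by (simp add: someI [of "\<lambda>x. least ?L x (idempotents S)"])
    then have b: "\<bottom>\<^bsub>?L\<^esub> \<in> idempotents S" "\<bottom>\<^bsub>?L\<^esub> \<sqsubseteq>\<^bsub>?L\<^esub> \<zero>"
      unfolding least_def by auto
    then have "\<bottom>\<^bsub>?L\<^esub> = \<bottom>\<^bsub>?L\<^esub> \<otimes> \<zero>" by (simp only: le)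
    also have "\<dots> = \<zero>" using b by simp
    finally show ?thesis .
  qed
  obtain k where k: "k \<in> idempotents S" "e \<sqinter>\<^bsub>?L\<^esub> k = \<bottom>\<^bsub>?L\<^esub>"
    "\<And>h. h \<in> idempotents S \<Longrightarrow> h \<sqinter>\<^bsub>?L\<^esub> e = \<bottom>\<^bsub>?L\<^esub> \<Longrightarrow> h \<sqsubseteq>\<^bsub>?L\<^esub> k"
    "\<And>h. h \<in> idempotents S \<Longrightarrow> h \<sqinter>\<^bsub>?L\<^esub> k = \<bottom>\<^bsub>?L\<^esub> \<Longrightarrow> h \<sqsubseteq>\<^bsub>?L\<^esub> e"
    using B.ex_complement_le [of e] e by auto
  have "complementary e k"
    unfolding complementary_def
  proof (intro conjI ballI impI)
    show "e \<otimes> k = \<zero>" using k(1,2) e meet bot by simp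
    show "h \<otimes> k = h" if "h \<in> idempotents S" "h \<otimes> e = \<zero>" for h
      using k(3) [of h] that e meet bot le by simp
    show "h \<otimes> e = h" if "h \<in> idempotents S" "h \<otimes> k = \<zero>" for h
      using k(4) [of h] k(1) that meet bot le by simp
  qed (rule e k(1))+
  then show ?thesis by blast
qed

end

section \<open>Ultrafilters in a Boolean inverse monoid with meets\<close>

context boolean_inverse_meet_monoid
begin

text \<open>A down-directed set need not contain the meets of its pairs, but a lower bound of a pair in the set
  lies below their meet, so the upward closure does contain it.\<close>

lemma up_closure_proper_filter:
  assumes D: "D \<subseteq> carrier S" "D \<noteq> {}" "\<zero> \<notin> D"
    and dir: "\<And>a b. a \<in> D \<Longrightarrow> b \<in> D \<Longrightarrow> \<exists>c \<in> D. c \<preceq> a \<and> c \<preceq> b"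
  shows "proper_filter S (up_closure S D)"
proof -
  let ?U = "up_closure S D"
  have mem: "x \<in> ?U \<longleftrightarrow> x \<in> carrier S \<and> (\<exists>d \<in> D. d \<preceq> x)" for x by (simp add: up_closure_def)
  have "\<zero> \<notin> ?U" using D le_zero mem by blast
  moreover have "?U \<noteq> {}" using D mem le_refl by blast
  moreover have "?U \<subseteq> carrier S" using mem by blast
  moreover have "b \<in> ?U" if "a \<in> ?U" "b \<in> carrier S" "a \<preceq> b" for a b
    using that D mem le_trans by (meson subset_iff)
  moreover have "\<exists>m \<in> ?U. is_meet S m {a, b}" if ab: "a \<in> ?U" "b \<in> ?U" for a b
  proof -
    obtain c d where cd: "c \<in> D" "d \<in> D" "c \<preceq> a" "d \<preceq> b" using ab mem by blast
    obtain x where x: "x \<in> D" "x \<preceq> c" "x \<preceq> d" using cd dir by blast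
    have cl: "a \<in> carrier S" "b \<in> carrier S" "c \<in> carrier S" "d \<in> carrier S" "x \<in> carrier S"
      using ab mem cd x D by auto
    obtain m where m: "is_meet S m {a, b}" using ex_meet cl by blast
    have "x \<preceq> a" "x \<preceq> b" using x cd cl le_trans by blast+
    then have "x \<preceq> m" "m \<in> carrier S" using m cl is_meet_iff by auto
    then show ?thesis using m x mem by blast
  qed
  ultimately show ?thesis unfolding proper_filter_def by blast
qed

text \<open>If every meet of \<open>x\<close> with a member of \<open>A\<close> were non-zero, these meets would generate a proper
  filter that contains both \<open>A\<close> and \<open>x\<close>, against maximality.\<close>

lemma ultrafilter_disjoint:
  assumes A: "A \<in> ultrafilters S" and x: "x \<in> carrier S" "x \<notin> A"
  obtains y where "y \<in> A" "\<And>z. z \<in> carrier S \<Longrightarrow> z \<preceq> x \<Longrightarrow> z \<preceq> y \<Longrightarrow> z = \<zero>"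
proof (rule ccontr)
  assume neg: "\<not> thesis"
  note witness = that
  have nz: "\<exists>z \<in> carrier S. z \<preceq> x \<and> z \<preceq> y \<and> z \<noteq> \<zero>" if "y \<in> A" for y
    using neg witness [OF that] by blast
  have pf: "proper_filter S A" by (rule ultrafilter_proper [OF A])
  define D where "D = {z. \<exists>y \<in> A. is_meet S z {x, y}}"
  have D: "z \<in> carrier S \<and> z \<preceq> x \<and> z \<preceq> y \<and> (\<forall>w \<in> carrier S. w \<preceq> x \<longrightarrow> w \<preceq> y \<longrightarrow> w \<preceq> z)"
    if "is_meet S z {x, y}" "y \<in> A" for z y
    using that x pf is_meet_iff [of x y z] proper_filter_closed by blast
  have ex: "\<exists>z \<in> D. is_meet S z {x, y}" if "y \<in> A" for y
    using that x pf ex_meet [of x y] proper_filter_closed unfolding D_def by blast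
  have Dc: "D \<subseteq> carrier S" using D unfolding D_def by blast
  have pfU: "proper_filter S (up_closure S D)"
  proof (rule up_closure_proper_filter)
    show "D \<subseteq> carrier S" by (rule Dc)
    show "D \<noteq> {}" using ex pf proper_filter_nonempty by blast
    show "\<zero> \<notin> D" using nz D le_zero unfolding D_def by blast
    fix a b assume "a \<in> D" "b \<in> D"
    then obtain y1 y2 where y: "y1 \<in> A" "y2 \<in> A" "is_meet S a {x, y1}" "is_meet S b {x, y2}"
      unfolding D_def by blast
    obtain y where y3: "y \<in> A" "y \<preceq> y1" "y \<preceq> y2" using y pf proper_filter_directed by metis
    obtain c where c: "c \<in> D" "is_meet S c {x, y}" using ex y3 by blast
    have "c \<in> carrier S" "c \<preceq> x" "c \<preceq> y" using D c y3 by blast+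
    moreover have "y \<in> carrier S" "y1 \<in> carrier S" "y2 \<in> carrier S"
      using y y3 pf proper_filter_closed by blast+
    ultimately have "c \<preceq> y1" "c \<preceq> y2" using y3 le_trans by blast+
    then show "\<exists>c \<in> D. c \<preceq> a \<and> c \<preceq> b"
      using c y D \<open>c \<in> carrier S\<close> \<open>c \<preceq> x\<close> by blast
  qed
  have sub: "A \<subseteq> up_closure S D"
    using ex D pf proper_filter_closed unfolding up_closure_def by blast
  moreover have "x \<in> up_closure S D"
    using ex D x pf proper_filter_nonempty unfolding up_closure_def by blast
  ultimately show False using ultrafilter_maximal [OF A pfU] x by blast
qed

lemma ultrafilter_disjoint_finite:
  assumes A: "A \<in> ultrafilters S" and X: "finite X" "X \<subseteq> carrier S" "X \<inter> A = {}"
  shows "\<exists>y \<in> A. \<forall>x \<in> X. \<forall>z \<in> carrier S. z \<preceq> x \<longrightarrow> z \<preceq> y \<longrightarrow> z = \<zero>"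
  using X
proof (induction X)
  case empty
  then show ?case using A ultrafilter_proper proper_filter_nonempty by blast
next
  case (insert x X)
  have pf: "proper_filter S A" by (rule ultrafilter_proper [OF A])
  obtain y1 where y1: "y1 \<in> A" "\<forall>x \<in> X. \<forall>z \<in> carrier S. z \<preceq> x \<longrightarrow> z \<preceq> y1 \<longrightarrow> z = \<zero>"
    using insert by auto
  obtain y2 where y2: "y2 \<in> A" "\<And>z. z \<in> carrier S \<Longrightarrow> z \<preceq> x \<Longrightarrow> z \<preceq> y2 \<Longrightarrow> z = \<zero>"
    using ultrafilter_disjoint [OF A, of x] insert by blast
  obtain y where y: "y \<in> A" "y \<preceq> y1" "y \<preceq> y2" using y1 y2 pf proper_filter_directed by metis
  have "y \<in> carrier S" "y1 \<in> carrier S" "y2 \<in> carrier S"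
    using y y1 y2 pf proper_filter_closed by blast+
  then show ?case using y y1(2) y2(2) le_trans by (metis insert_iff)
qed

text \<open>If \<open>A\<close> missed \<open>X\<close>, some \<open>y \<le> a\<close> in \<open>A\<close> would be disjoint from all of \<open>X\<close>. Then each
  \<open>x \<in> X\<close> is killed by \<open>f = y\<^sup>-\<^sup>1y\<close> and so survives multiplication by its complement \<open>g\<close>. Thus
  \<open>ag\<close> is an upper bound of \<open>X\<close> and \<open>a \<le> ag\<close>, whence \<open>y = af \<le> agf = 0\<close>.\<close>

lemma ultrafilter_prime:
  assumes A: "A \<in> ultrafilters S" and X: "finite X" "X \<subseteq> carrier S"
    and a: "a \<in> A" "is_join S a X"
  shows "X \<inter> A \<noteq> {}"
proof
  assume "X \<inter> A = {}"
  then obtain y0 where y0: "y0 \<in> A"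
    and dis: "\<And>x z. x \<in> X \<Longrightarrow> z \<in> carrier S \<Longrightarrow> z \<preceq> x \<Longrightarrow> z \<preceq> y0 \<Longrightarrow> z = \<zero>"
    using ultrafilter_disjoint_finite [OF A X] by blast
  have pf: "proper_filter S A" by (rule ultrafilter_proper [OF A])
  obtain y where y: "y \<in> A" "y \<preceq> a" "y \<preceq> y0" using pf a y0 proper_filter_directed by metis
  have cl [simp]: "a \<in> carrier S" "y \<in> carrier S" "y0 \<in> carrier S"
    using a y y0 pf proper_filter_closed by blast+
  let ?f = "y\<^sup>\<star> \<otimes> y"
  have ya: "y = a \<otimes> ?f" using y le_iff_dom by simp
  obtain g where gc: "complementary ?f g"
    using ex_complementary [of "?f"] by auto
  note g = complementaryD [OF gc]
  have ub: "x \<preceq> a \<otimes> g" if x: "x \<in> X" for x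
  proof -
    have xc [simp]: "x \<in> carrier S" using x X by blast
    have xa: "x \<preceq> a" using x a X is_join_iff by blast
    have "x \<otimes> ?f \<preceq> y" using le_mult_right [OF xa, of ?f] ya by simp
    then have "x \<otimes> ?f \<preceq> y0" using y(3) le_trans by (meson cl m_closed sinv_closed xc)
    moreover have "x \<otimes> ?f \<preceq> x" by (simp add: mult_idem_le)
    ultimately have "x \<otimes> ?f = \<zero>" using dis x by simp
    then have "x\<^sup>\<star> \<otimes> x \<otimes> ?f = \<zero>" by (simp add: m_assoc)
    then have "x\<^sup>\<star> \<otimes> x \<otimes> g = x\<^sup>\<star> \<otimes> x" using g(4) by simp
    then have "x \<otimes> (x\<^sup>\<star> \<otimes> x \<otimes> g) = x" by (simp add: mult_sinv_mult)
    then have "x \<otimes> (x\<^sup>\<star> \<otimes> x) \<otimes> g = x" using g(1) by (simp add: m_assoc)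
    then have "x \<otimes> g = x" by (simp add: mult_sinv_mult)
    then show ?thesis using le_mult_right [OF xa, of g] g(1) by simp
  qed
  have "a \<preceq> a \<otimes> g" using a(2) X(2) ub g(1) is_join_iff by simp
  then have "a \<otimes> ?f \<preceq> a \<otimes> g \<otimes> ?f" using g(1) by (simp add: le_mult_right)
  also have "a \<otimes> g \<otimes> ?f = a \<otimes> (?f \<otimes> g)" using g(1) idem_comm [of ?f g] by (simp add: m_assoc)
  also have "\<dots> = \<zero>" using g(2) by simp
  finally have "y = \<zero>" using ya le_zero by simp
  then show False using y pf proper_filter_zero by blast
qed

text \<open>This is primeness for the decomposition of \<open>c\<close> into \<open>ec\<close> and \<open>kc\<close>: an element of \<open>A\<close> below
  \<open>c\<close> and disjoint from \<open>kc\<close> is annihilated by \<open>k\<close>, hence fixed by \<open>e\<close>, hence below \<open>ec\<close>.\<close>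

lemma ultrafilter_split:
  assumes A: "A \<in> ultrafilters S" and c: "c \<in> A"
    and compl: "complementary e k"
    and k: "k \<otimes> c \<notin> A"
  shows "e \<otimes> c \<in> A"
proof -
  note ek = complementaryD [OF compl]
  have pf: "proper_filter S A" by (rule ultrafilter_proper [OF A])
  have cc [simp]: "c \<in> carrier S" using c pf proper_filter_closed by blast
  have [simp]: "e \<in> carrier S" "k \<in> carrier S" using ek by simp_all
  obtain y0 where y0: "y0 \<in> A"
    and dis: "\<And>z. z \<in> carrier S \<Longrightarrow> z \<preceq> k \<otimes> c \<Longrightarrow> z \<preceq> y0 \<Longrightarrow> z = \<zero>"
    using ultrafilter_disjoint [OF A _ k] by auto
  obtain y where y: "y \<in> A" "y \<preceq> c" "y \<preceq> y0" using pf c y0 proper_filter_directed by metis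
  have cl [simp]: "y \<in> carrier S" "y0 \<in> carrier S" using y y0 pf proper_filter_closed by blast+
  have "k \<otimes> y \<preceq> y0" using idem_mult_le [of y k] ek(1) y(3) le_trans cl m_closed \<open>k \<in> carrier S\<close>
    by metis
  moreover have "k \<otimes> y \<preceq> k \<otimes> c" using y(2) by (simp add: le_mult_left)
  ultimately have "k \<otimes> y = \<zero>" using dis by simp
  then have "k \<otimes> (y \<otimes> y\<^sup>\<star>) = \<zero>" by (simp add: m_assoc [symmetric])
  then have "(y \<otimes> y\<^sup>\<star>) \<otimes> k = \<zero>" using idem_comm [of k "y \<otimes> y\<^sup>\<star>"] ek(1) by simp
  then have "(y \<otimes> y\<^sup>\<star>) \<otimes> e = y \<otimes> y\<^sup>\<star>" using ek(5) by simp
  then have "e \<otimes> (y \<otimes> y\<^sup>\<star>) = y \<otimes> y\<^sup>\<star>" using idem_comm [of e "y \<otimes> y\<^sup>\<star>"] ek(3) by simp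
  then have "e \<otimes> (y \<otimes> y\<^sup>\<star>) \<otimes> y = y \<otimes> y\<^sup>\<star> \<otimes> y" by simp
  then have "e \<otimes> y = y" by (simp add: m_assoc mult_sinv_mult)
  moreover have "e \<otimes> y \<preceq> e \<otimes> c" using y(2) by (simp add: le_mult_left)
  ultimately show ?thesis using y(1) pf proper_filter_up by (metis cc \<open>e \<in> carrier S\<close> m_closed)
qed

text \<open>Let \<open>c \<in> A\<close> with \<open>e = c\<^sup>-\<^sup>1c\<close> and \<open>f = cc\<^sup>-\<^sup>1\<close>. As soon as \<open>ec \<in> A\<close>, the range of \<open>A\<close>
  contains \<open>e\<close>, because \<open>(ec)(ec)\<^sup>-\<^sup>1 \<le> e\<close>; likewise \<open>cf \<in> A\<close> puts \<open>f\<close> into the domain.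
  Both memberships come from splitting \<open>c\<close>, as the discarded part squares to zero.\<close>

lemma dom_eq_ran_if_no_infinitesimal:
  assumes A: "A \<in> ultrafilters S" and no: "A \<inter> infinitesimals S = {}"
  shows "uf_dom S A = uf_ran S A"
proof -
  have pf: "proper_filter S A" by (rule ultrafilter_proper [OF A])
  have nz: "s \<otimes> s \<noteq> \<zero>" if "s \<in> A" for s
    using that no pf proper_filter_closed proper_filter_zero unfolding infinitesimals_def by blast
  have key: "c \<otimes> (c \<otimes> c\<^sup>\<star>) \<in> A" "c\<^sup>\<star> \<otimes> c \<otimes> c \<in> A" if c: "c \<in> A" for c
  proof -
    have cc [simp]: "c \<in> carrier S" using c pf proper_filter_closed by blast
    let ?e = "c\<^sup>\<star> \<otimes> c" and ?f = "c \<otimes> c\<^sup>\<star>"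
    obtain k where kc: "complementary ?e k"
      using ex_complementary [of "?e"] by auto
    note k = complementaryD [OF kc]
    have "(k \<otimes> c) \<otimes> (k \<otimes> c) = k \<otimes> (c \<otimes> ?e) \<otimes> (k \<otimes> c)" by (simp add: mult_sinv_mult)
    also have "\<dots> = k \<otimes> c \<otimes> (?e \<otimes> k) \<otimes> c" using k(1) by (simp add: m_assoc)
    also have "\<dots> = \<zero>" using k(1,2) by simp
    finally have "k \<otimes> c \<notin> A" using nz by blast
    then show "?e \<otimes> c \<in> A" using ultrafilter_split [OF A c kc] by simp
    \<comment> \<open>Conjugating \<open>f\<close> turns \<open>cf\<close> into a left multiple of \<open>c\<close>, so that the same splitting
      applies.\<close>
    let ?g = "c \<otimes> ?f \<otimes> c\<^sup>\<star>"
    have g: "?g \<in> idempotents S" "?g \<otimes> c = c \<otimes> ?f"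
      using conj_idem [of c ?f] mult_idem_swap [of c ?f] by simp_all
    obtain l where lc: "complementary ?g l"
      using ex_complementary [OF g(1)] by blast
    note l = complementaryD [OF lc]
    have lg: "l \<otimes> ?g = \<zero>" using idem_comm [OF l(1) g(1)] l(2) by (simp only:)
    have fc: "?f \<otimes> (l \<otimes> c) = l \<otimes> c"
    proof -
      have "?f \<otimes> (l \<otimes> c) = (?f \<otimes> l) \<otimes> c" using l(1) by (simp add: m_assoc)
      also have "\<dots> = (l \<otimes> ?f) \<otimes> c" using idem_comm [of ?f l] l(1) by simp
      also have "\<dots> = l \<otimes> c" using l(1) by (simp add: m_assoc mult_sinv_mult)
      finally show ?thesis .
    qed
    have "(l \<otimes> c) \<otimes> (l \<otimes> c) = (l \<otimes> c) \<otimes> (?f \<otimes> (l \<otimes> c))" by (simp only: fc)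
    also have "\<dots> = l \<otimes> (c \<otimes> ?f) \<otimes> (l \<otimes> c)" using l(1) by (simp add: m_assoc)
    also have "\<dots> = l \<otimes> (?g \<otimes> c) \<otimes> (l \<otimes> c)" by (simp only: g(2))
    also have "\<dots> = (l \<otimes> ?g) \<otimes> (c \<otimes> (l \<otimes> c))"
      using l(1) idempotents_closed [OF g(1)] by (simp only: m_assoc m_closed idempotents_closed cc)
    also have "\<dots> = \<zero>" using lg l(1) by simp
    finally have "l \<otimes> c \<notin> A" using nz by blast
    then have "?g \<otimes> c \<in> A" using ultrafilter_split [OF A c lc] by simp
    then show "c \<otimes> ?f \<in> A" by (simp only: g(2))
  qed
  show ?thesis
  proof (intro Set.set_eqI iffI)
    fix x assume "x \<in> uf_dom S A"
    then obtain c where c: "c \<in> A" "c\<^sup>\<star> \<otimes> c \<preceq> x" and x: "x \<in> carrier S"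
      using pf mem_uf_dom_iff by blast
    have cc [simp]: "c \<in> carrier S" using c pf proper_filter_closed by blast
    let ?e = "c\<^sup>\<star> \<otimes> c" and ?s = "c\<^sup>\<star> \<otimes> c \<otimes> c"
    have "?s \<otimes> ?s\<^sup>\<star> = ?e \<otimes> (c \<otimes> c\<^sup>\<star> \<otimes> ?e)" by (simp add: sinv_mult m_assoc)
    then have "?s \<otimes> ?s\<^sup>\<star> \<preceq> ?e" by (simp add: mult_idem_le)
    then have "?s \<otimes> ?s\<^sup>\<star> \<preceq> x" using c(2) x le_trans by (meson cc m_closed sinv_closed)
    then show "x \<in> uf_ran S A" using key(2) [OF c(1)] x pf mem_uf_ran_iff by blast
  next
    fix x assume "x \<in> uf_ran S A"
    then obtain c where c: "c \<in> A" "c \<otimes> c\<^sup>\<star> \<preceq> x" and x: "x \<in> carrier S"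
      using pf mem_uf_ran_iff by blast
    have cc [simp]: "c \<in> carrier S" using c pf proper_filter_closed by blast
    let ?f = "c \<otimes> c\<^sup>\<star>" and ?s = "c \<otimes> (c \<otimes> c\<^sup>\<star>)"
    have "?s\<^sup>\<star> \<otimes> ?s = ?f \<otimes> (c\<^sup>\<star> \<otimes> c \<otimes> ?f)" by (simp add: sinv_mult m_assoc)
    then have "?s\<^sup>\<star> \<otimes> ?s \<preceq> ?f" by (simp add: mult_idem_le)
    then have "?s\<^sup>\<star> \<otimes> ?s \<preceq> x" using c(2) x le_trans by (meson cc m_closed sinv_closed)
    then show "x \<in> uf_dom S A" using key(1) [OF c(1)] x pf mem_uf_dom_iff by blast
  qed
qed

text \<open>The set \<open>G\<close> consists of the idempotents that lie above the complement of
  \<open>b\<^sub>1\<^sup>-\<^sup>1b\<^sub>1 \<or> \<dots> \<or> b\<^sub>n\<^sup>-\<^sup>1b\<^sub>n\<close> for finitely many \<open>b\<^sub>i \<in> X\<close>. The elements \<open>ag\<close> with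
  \<open>g \<in> G\<close> form a down-directed set, and \<open>ag = 0\<close> would mean that the \<open>b\<^sub>i\<close>
  already exhaust \<open>a\<close>, so that \<open>a\<close> is their join. An ultrafilter that contains all \<open>ag\<close> cannot
  contain any \<open>b \<in> X\<close>, because \<open>a\<close> times the complement of \<open>b\<^sup>-\<^sup>1b\<close> is disjoint from \<open>b\<close>.\<close>

lemma ex_ultrafilter_avoiding:
  assumes a: "a \<in> carrier S" and X: "X \<subseteq> carrier S" "\<And>x. x \<in> X \<Longrightarrow> x \<preceq> a"
    and nj: "\<And>Y. finite Y \<Longrightarrow> Y \<subseteq> X \<Longrightarrow> \<not> is_join S a Y"
  obtains A where "A \<in> ultrafilters S" "a \<in> A" "A \<inter> X = {}"
proof -
  note [simp] = a
  define annihilates where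
    "annihilates = (\<lambda>h Y. \<forall>b \<in> Y. h \<otimes> (b\<^sup>\<star> \<otimes> b) = \<zero>)"
  define G where "G = {g \<in> idempotents S. \<exists>Y. finite Y \<and> Y \<subseteq> X \<and>
    (\<forall>h \<in> idempotents S. annihilates h Y \<longrightarrow> h \<otimes> g = h)}"
  define D where "D = (\<lambda>g. a \<otimes> g) ` G"
  have Gi: "g \<in> idempotents S" if "g \<in> G" for g using that by (simp add: G_def)
  have one: "\<one> \<in> G" unfolding G_def by (auto intro!: exI [of _ "{}"])
  have Gmult: "g \<otimes> g' \<in> G" if g: "g \<in> G" "g' \<in> G" for g g'
  proof -
    obtain Y Y' where Y: "finite Y" "Y \<subseteq> X"
        "\<And>h. h \<in> idempotents S \<Longrightarrow> annihilates h Y \<Longrightarrow> h \<otimes> g = h"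
      and Y': "finite Y'" "Y' \<subseteq> X"
        "\<And>h. h \<in> idempotents S \<Longrightarrow> annihilates h Y' \<Longrightarrow> h \<otimes> g' = h"
      using g unfolding G_def by blast
    have "h \<otimes> (g \<otimes> g') = h" if h: "h \<in> idempotents S" "annihilates h (Y \<union> Y')" for h
    proof -
      have "h \<otimes> g = h" "h \<otimes> g' = h" using h Y(3) Y'(3) unfolding annihilates_def by blast+
      then show ?thesis using h g Gi by (metis idempotents_closed m_assoc)
    qed
    moreover have "finite (Y \<union> Y')" "Y \<union> Y' \<subseteq> X" using Y Y' by auto
    moreover have "g \<otimes> g' \<in> idempotents S" using g Gi by blast
    ultimately show ?thesis unfolding G_def by blast
  qed
  have D0: "\<zero> \<notin> D"
  proof
    assume "\<zero> \<in> D"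
    then obtain g where g: "g \<in> G" and ag: "a \<otimes> g = \<zero>" unfolding D_def by force
    obtain Y where Y: "finite Y" "Y \<subseteq> X"
        "\<And>h. h \<in> idempotents S \<Longrightarrow> annihilates h Y \<Longrightarrow> h \<otimes> g = h"
      using g unfolding G_def by blast
    have gi [simp]: "g \<in> idempotents S" using g Gi by simp
    let ?d = "a\<^sup>\<star> \<otimes> a"
    have dg: "?d \<otimes> g = \<zero>" using ag by (simp add: m_assoc)
    have "is_join S a Y"
    proof -
      have "a \<preceq> u" if u: "u \<in> carrier S" "\<And>b. b \<in> Y \<Longrightarrow> b \<preceq> u" for u
      proof -
        \<comment> \<open>The meet \<open>m\<close> is above all of \<open>Y\<close>, so the part \<open>dk\<close> of \<open>d = a\<^sup>-\<^sup>1a\<close> outside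
          \<open>m\<^sup>-\<^sup>1m\<close> misses \<open>Y\<close> and is therefore below \<open>g\<close>; but \<open>dg = 0\<close>. Hence \<open>m = a\<close>.\<close>
        obtain m where m: "is_meet S m {a, u}" using ex_meet [OF a u(1)] by blast
        then have mc [simp]: "m \<in> carrier S" and ma: "m \<preceq> a" "m \<preceq> u"
          and mg: "\<And>x. x \<in> carrier S \<Longrightarrow> x \<preceq> a \<Longrightarrow> x \<preceq> u \<Longrightarrow> x \<preceq> m"
          using is_meet_iff [OF a u(1)] by auto
        obtain k where kc: "complementary (m\<^sup>\<star> \<otimes> m) k"
          using ex_complementary [of "m\<^sup>\<star> \<otimes> m"] by auto
        note k = complementaryD [OF kc]
        have "annihilates (?d \<otimes> k) Y" unfolding annihilates_def
        proof
          fix b assume b: "b \<in> Y"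
          then have bc [simp]: "b \<in> carrier S" using Y X by blast
          have "b \<preceq> m" using b u X Y mg by blast
          then have "b\<^sup>\<star> \<otimes> b \<preceq> m\<^sup>\<star> \<otimes> m" by (simp add: dom_mono)
          then have "k \<otimes> (b\<^sup>\<star> \<otimes> b) \<preceq> k \<otimes> (m\<^sup>\<star> \<otimes> m)" using k(1) by (simp add: le_mult_left)
          also have "k \<otimes> (m\<^sup>\<star> \<otimes> m) = \<zero>" using k(1,2) idem_comm [of k "m\<^sup>\<star> \<otimes> m"] by simp
          finally have "k \<otimes> (b\<^sup>\<star> \<otimes> b) = \<zero>" using k(1) le_zero by simp
          then show "?d \<otimes> k \<otimes> (b\<^sup>\<star> \<otimes> b) = \<zero>" using k(1) by (simp add: m_assoc)
        qed
        then have "?d \<otimes> k \<otimes> g = ?d \<otimes> k" using Y(3) k(1) by simp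
        moreover have "?d \<otimes> k \<otimes> g = ?d \<otimes> g \<otimes> k"
          using k(1) idem_comm [of k g] by (simp add: m_assoc)
        ultimately have "?d \<otimes> k = \<zero>" using dg k(1) by simp
        then have "?d \<otimes> (m\<^sup>\<star> \<otimes> m) = ?d" using k(5) by simp
        then have "a \<otimes> ?d \<otimes> (m\<^sup>\<star> \<otimes> m) = a \<otimes> ?d" by (simp add: m_assoc)
        then have "a \<otimes> (m\<^sup>\<star> \<otimes> m) = a" by (simp add: mult_sinv_mult)
        then have "m = a" using ma(1) le_iff_dom [of m a] by simp
        then show ?thesis using ma by simp
      qed
      then show ?thesis using Y X by (subst is_join_iff) auto
    qed
    then show False using nj Y by blast
  qed
  have pf: "proper_filter S (up_closure S D)"
  proof (rule up_closure_proper_filter)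
    show "D \<subseteq> carrier S" using Gi by (auto simp: D_def)
    show "D \<noteq> {}" using one by (auto simp: D_def)
    show "\<zero> \<notin> D" by (rule D0)
    fix x y assume "x \<in> D" "y \<in> D"
    then obtain g g' where g: "g \<in> G" "g' \<in> G" "x = a \<otimes> g" "y = a \<otimes> g'" by (auto simp: D_def)
    have gi [simp]: "g \<in> idempotents S" "g' \<in> idempotents S" using g Gi by auto
    have 1: "a \<otimes> (g \<otimes> g') \<preceq> x" using mult_idem_le [of "a \<otimes> g" g'] g by (simp add: m_assoc)
    have "a \<otimes> (g' \<otimes> g) \<preceq> y" using mult_idem_le [of "a \<otimes> g'" g] g by (simp add: m_assoc)
    then have "a \<otimes> (g \<otimes> g') \<preceq> y" using idem_comm [of g g'] by simp
    then show "\<exists>c \<in> D. c \<preceq> x \<and> c \<preceq> y" using 1 Gmult g unfolding D_def by blast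
  qed
  obtain A where A: "A \<in> ultrafilters S" "up_closure S D \<subseteq> A" using ex_ultrafilter [OF pf] by blast
  have AG: "a \<otimes> g \<in> A" if "g \<in> G" for g
    using that A(2) Gi unfolding D_def up_closure_def by force
  have "a \<in> A" using AG [OF one] by simp
  moreover have "b \<notin> A" if b: "b \<in> X" for b
  proof
    assume bA: "b \<in> A"
    have bc [simp]: "b \<in> carrier S" using b X by blast
    obtain k where kc: "complementary (b\<^sup>\<star> \<otimes> b) k"
      using ex_complementary [of "b\<^sup>\<star> \<otimes> b"] by auto
    note k = complementaryD [OF kc]
    have "finite {b}" "{b} \<subseteq> X" using b by auto
    moreover have "\<forall>h \<in> idempotents S. annihilates h {b} \<longrightarrow> h \<otimes> k = h"
      using k(4) unfolding annihilates_def by blast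
    ultimately have "k \<in> G" unfolding G_def using k(1) by blast
    then have "a \<otimes> k \<in> A" by (rule AG)
    then obtain c where c: "c \<in> A" "c \<preceq> a \<otimes> k" "c \<preceq> b"
      using bA proper_filter_directed ultrafilter_proper A(1) by metis
    have cc [simp]: "c \<in> carrier S" using c A ultrafilter_proper proper_filter_closed by blast
    obtain p where p: "p \<in> idempotents S" "c = a \<otimes> k \<otimes> p"
      using c(2) k(1) le_iff_ex_idem_right [of c "a \<otimes> k"] by auto
    have "c \<otimes> k = a \<otimes> (k \<otimes> (p \<otimes> k))" using p k(1) by (simp add: m_assoc)
    also have "p \<otimes> k = k \<otimes> p" using p k(1) idem_comm by simp
    also have "a \<otimes> (k \<otimes> (k \<otimes> p)) = c" using p k(1) by (simp add: m_assoc idem_idem_left)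
    finally have ck: "c \<otimes> k = c" .
    have "b \<otimes> k = b \<otimes> (b\<^sup>\<star> \<otimes> b) \<otimes> k" by (simp add: mult_sinv_mult)
    also have "\<dots> = b \<otimes> (b\<^sup>\<star> \<otimes> b \<otimes> k)" using k(1) by (simp add: m_assoc)
    also have "\<dots> = \<zero>" using k(2) by simp
    finally have "c \<otimes> k \<preceq> \<zero>" using le_mult_right [OF c(3), of k] k(1) by simp
    then have "c = \<zero>" using ck le_zero by simp
    then show False using c A ultrafilter_proper proper_filter_zero by blast
  qed
  ultimately show ?thesis using that A(1) by blast
qed

lemma principal_if_basic:
  assumes "basic S"
  shows "principal_groupoid (ultrafilter_groupoid S)"
  unfolding principal_iff
proof (intro ballI impI)
  fix A assume A: "A \<in> ultrafilters S" and eq: "uf_dom S A = uf_ran S A"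
  have pf: "proper_filter S A" by (rule ultrafilter_proper [OF A])
  obtain a where a: "a \<in> A" using pf proper_filter_nonempty by blast
  then have "a \<in> carrier S" "a \<noteq> \<zero>" using pf proper_filter_closed proper_filter_zero by auto
  then obtain I e where I: "finite I" "I \<subseteq> infinitesimals S" and e: "e \<in> idempotents S"
    and join: "is_join S a (insert e I)"
    using assms unfolding basic_def by blast
  have "insert e I \<subseteq> carrier S" using I e by (auto simp: infinitesimals_def)
  then have "insert e I \<inter> A \<noteq> {}" using ultrafilter_prime [OF A _ _ a join] I by simp
  then have "e \<in> A" using infinitesimal_separates [OF A] eq I by blast
  then show "A \<in> uf_dom S ` ultrafilters S" using identity_if_idem [OF A _ e] A by force
qed

lemma basic_if_principal:
  assumes pr: "principal_groupoid (ultrafilter_groupoid S)"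
  shows "basic S"
  unfolding basic_def
proof (intro ballI impI)
  fix a assume a [simp]: "a \<in> carrier S"
  \<comment> \<open>The largest idempotent below \<open>a\<close>; it stands for all idempotents below \<open>a\<close> in the cover.\<close>
  obtain e where "is_meet S e {a, \<one>}" using ex_meet [OF a one_closed] by blast
  then have ec: "e \<in> carrier S" "e \<preceq> a" "e \<preceq> \<one>"
    and emax: "\<And>x. x \<in> carrier S \<Longrightarrow> x \<preceq> a \<Longrightarrow> x \<preceq> \<one> \<Longrightarrow> x \<preceq> e"
    using is_meet_iff [of a \<one>] by auto
  have e: "e \<in> idempotents S" by (rule le_idem [OF ec(3,1) one_idempotent])
  let ?X = "insert e {b \<in> infinitesimals S. b \<preceq> a}"
  have Xc: "?X \<subseteq> carrier S" using ec by (auto simp: infinitesimals_def)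
  have "\<exists>Y. finite Y \<and> Y \<subseteq> ?X \<and> is_join S a Y"
  proof (rule ccontr)
    assume "\<nexists>Y. finite Y \<and> Y \<subseteq> ?X \<and> is_join S a Y"
    then have nj: "\<not> is_join S a Y" if "finite Y" "Y \<subseteq> ?X" for Y using that by blast
    have Xa: "x \<preceq> a" if "x \<in> ?X" for x using that ec by blast
    obtain A where A: "A \<in> ultrafilters S" and aA: "a \<in> A" and AX: "A \<inter> ?X = {}"
      by (rule ex_ultrafilter_avoiding [OF a Xc Xa nj])
    have pf: "proper_filter S A" by (rule ultrafilter_proper [OF A])
    have "s \<notin> infinitesimals S" if s: "s \<in> A" for s
    proof
      assume inf: "s \<in> infinitesimals S"
      obtain c where c: "c \<in> A" "c \<preceq> s" "c \<preceq> a" using s aA pf proper_filter_directed by metis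
      have sc: "s \<in> carrier S" "s \<otimes> s = \<zero>" using inf by (auto simp: infinitesimals_def)
      have cc: "c \<in> carrier S" "c \<noteq> \<zero>" using c pf proper_filter_closed proper_filter_zero by auto
      have "c \<otimes> c \<preceq> s \<otimes> s" using le_mult [OF c(2) c(2)] sc(1) cc(1) by blast
      then have "c \<in> infinitesimals S" using sc cc le_zero by (simp add: infinitesimals_def)
      then show False using AX c by blast
    qed
    then have "uf_dom S A = uf_ran S A" using dom_eq_ran_if_no_infinitesimal [OF A] by blast
    then obtain B where "B \<in> ultrafilters S" "A = uf_dom S B" using pr A principal_iff by blast
    then obtain f where f: "f \<in> idempotents S" "f \<in> A" using idem_in_identity by metis
    obtain c where c: "c \<in> A" "c \<preceq> f" "c \<preceq> a" using f aA pf proper_filter_directed by metis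
    have cc: "c \<in> carrier S" using c pf proper_filter_closed by auto
    then have "c \<in> idempotents S" using c f le_idem by blast
    then have "c \<preceq> \<one>" by (simp add: le_idem_iff)
    then have "c \<preceq> e" using emax c cc by blast
    then have "e \<in> A" using c pf ec proper_filter_up by blast
    then show False using AX by blast
  qed
  then obtain Y where Y: "finite Y" "Y \<subseteq> ?X" "is_join S a Y" by blast
  \<comment> \<open>The finite subfamily may omit \<open>e\<close>; adding it does no harm, as \<open>e \<le> a\<close>.\<close>
  have "is_join S a (insert e (Y - {e}))"
  proof -
    have "Y \<subseteq> carrier S" using Y Xc by blast
    then show ?thesis using Y(3) ec by (subst is_join_iff) (auto simp: is_join_iff)
  qed
  moreover have "Y - {e} \<subseteq> infinitesimals S" using Y by blast
  ultimately show "\<exists>I e. finite I \<and> I \<subseteq> infinitesimals S \<and> e \<in> idempotents S \<and>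
      is_join S a (insert e I)"
    using Y e by blast
qed

end

theorem proposition4p31:
  fixes S (structure)
  assumes "boolean_inverse_meet_monoid S"
  shows "principal_groupoid (ultrafilter_groupoid S) \<longleftrightarrow> basic S"
proof -
  interpret boolean_inverse_meet_monoid S by (rule assms)
  show ?thesis using principal_if_basic basic_if_principal by blast
qed

end
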